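(* For every integer $d\ge 2$ there exists $\varepsilon_d>0$ such that for every integer $n>d$, $$|\mathcal T_{n,d}|<\left(\frac{e-\varepsilon_d}{d+1}\,n\right)^{\binom{n-1}{d}},$$ where $\mathcal T_{n,d}$ is the set of $d$-hypertrees on the labeled vertex set $[n]=\{1,\dots,n\}$.
   Context: A $d$-dimensional simplicial complex on the vertex set $[n]$ has a full $(d-1)$-skeleton if it contains every nonempty subset of $[n]$ of size at most $d$. A $d$-hypertree is a $d$-dimensional simplicial complex $T$ with a full $(d-1)$-skeleton such that $H_{d-1}(T;\mathbb Q)=0$ and $H_d(T;\mathbb Q)=0$. Equivalently, it is a set of $d$-faces (subsets of $[n]$ of size $d+1$) whose corresponding columns in the $d$-dimensional simplicial boundary matrix over $\mathbb Q$ of the complete complex on $[n]$ form a basis of the column space; in particular it has exactly $\binom{n-1}{d}$ $d$-faces. Hypertrees are counted as labeled objects. *)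

theory Defs
  imports Complex_Main "HOL-Algebra.Elementary_Groups"
begin

text \<open>Abstract simplicial complexes are families of \<^emph>\<open>nonempty\<close> sets of vertices, with vertex set
  \<open>{1..n}\<close>.\<close>

definition complex_on :: "nat \<Rightarrow> nat set set \<Rightarrow> bool" where
  "complex_on n K \<longleftrightarrow>
     {} \<notin> K \<and> (\<forall>\<sigma>\<in>K. \<sigma> \<subseteq> {1..n}) \<and> (\<forall>\<sigma>\<in>K. \<forall>\<rho>. \<rho> \<subseteq> \<sigma> \<and> \<rho> \<noteq> {} \<longrightarrow> \<rho> \<in> K)"

definition faces :: "nat set set \<Rightarrow> nat \<Rightarrow> nat set set" where
  "faces K p = {\<sigma> \<in> K. card \<sigma> = p + 1}"

definition has_dimension :: "nat set set \<Rightarrow> nat \<Rightarrow> bool" where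
  "has_dimension K d \<longleftrightarrow> faces K d \<noteq> {} \<and> (\<forall>\<sigma>\<in>K. card \<sigma> \<le> d + 1)"

definition full_skeleton :: "nat \<Rightarrow> nat \<Rightarrow> nat set set \<Rightarrow> bool" where
  "full_skeleton n d K \<longleftrightarrow> (\<forall>\<sigma>. \<sigma> \<subseteq> {1..n} \<and> \<sigma> \<noteq> {} \<and> card \<sigma> \<le> d \<longrightarrow> \<sigma> \<in> K)"

text \<open>Entries of the simplicial boundary matrix. Simplices are oriented by the order of the vertices,
  so deleting \<open>v\<close> from \<open>\<sigma>\<close> carries the sign \<open>(-1)\<^sup>i\<close>, where \<open>i\<close> is the position (counted from 0) of
  \<open>v\<close> in the increasing enumeration of \<open>\<sigma>\<close>.\<close>

definition incidence :: "nat set \<Rightarrow> nat set \<Rightarrow> rat" where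
  "incidence \<rho> \<sigma> = (\<Sum>v\<in>\<sigma>. if \<rho> = \<sigma> - {v} then (- 1) ^ card {u \<in> \<sigma>. u < v} else 0)"

definition rational_chains :: "nat set set \<Rightarrow> nat \<Rightarrow> (nat set \<Rightarrow> rat) set" where
  "rational_chains K p = {c. \<forall>\<sigma>. \<sigma> \<notin> faces K p \<longrightarrow> c \<sigma> = 0}"

text \<open>As \<open>{} \<notin> K\<close> for a complex \<open>K\<close>, the boundary of a 0-chain is zero and the homology below is
  unreduced; it agrees with reduced homology in all degrees \<open>p \<ge> 1\<close>.\<close>

definition boundary_map :: "nat set set \<Rightarrow> nat \<Rightarrow> (nat set \<Rightarrow> rat) \<Rightarrow> nat set \<Rightarrow> rat" where
  "boundary_map K p c = (\<lambda>\<rho>. if \<rho> \<in> K then \<Sum>\<sigma>\<in>faces K p. incidence \<rho> \<sigma> * c \<sigma> else 0)"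

definition cycle_group :: "nat set set \<Rightarrow> nat \<Rightarrow> (nat set \<Rightarrow> rat) monoid" where
  "cycle_group K p =
     \<lparr>carrier = {c \<in> rational_chains K p. boundary_map K p c = (\<lambda>_. 0)},
      mult = (\<lambda>c c' \<sigma>. c \<sigma> + c' \<sigma>), one = (\<lambda>_. 0)\<rparr>"

text \<open>The additive group of \<open>H\<^sub>p(K; \<rat>)\<close>.\<close>

definition rational_homology_group :: "nat set set \<Rightarrow> nat \<Rightarrow> (nat set \<Rightarrow> rat) set monoid" where
  "rational_homology_group K p = cycle_group K p Mod (boundary_map K (p + 1) ` rational_chains K (p + 1))"

definition hypertree :: "nat \<Rightarrow> nat \<Rightarrow> nat set set \<Rightarrow> bool" where
  "hypertree n d T \<longleftrightarrow>
     complex_on n T \<and> has_dimension T d \<and> full_skeleton n d T \<and>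
     trivial_group (rational_homology_group T (d - 1)) \<and>
     trivial_group (rational_homology_group T d)"

definition hypertrees :: "nat \<Rightarrow> nat \<Rightarrow> nat set set set" where
  "hypertrees n d = {T. hypertree n d T}"

end

theory Submission imports Defs "HOL-Analysis.Convex" begin

text \<open>Since \<open>H\<^sub>d\<close> vanishes, a hypertree has at most \<open>k = n - 1 choose d\<close> \<open>d\<close>-faces, and counting
  \<open>k\<close>-subsets gives the constant \<open>e\<close>. The gain comes from the vanishing of
  \<open>H\<^bsub>d-1\<^esub>\<close>, which forces every \<open>d\<close>-set of vertices to lie in a \<open>d\<close>-face. Weight each family of
  \<open>d\<close>-faces by \<open>x\<close> to its size, with \<open>x = (d+1)/n\<close>. As each \<open>d\<close>-face contains exactly \<open>d+1\<close> of the
  \<open>d\<close>-sets, Finner's inequality bounds the total weight of the covering families by the product over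
  all \<open>d\<close>-sets of \<open>((1+x)\<^bsup>n-d\<^esup> - 1)\<^bsup>1/(d+1)\<^esup>\<close>, where the \<open>- 1\<close> excludes the empty star.
  This saves a constant factor below 1 for each \<open>d\<close>-set.\<close>

subsection \<open>Finner's inequality for set families\<close>

text \<open>Superadditivity of the geometric mean. After division by the right-hand side, AM-GM
  bounds the two terms by the averages of \<open>a i / (a i + b i)\<close> and
  \<open>b i / (a i + b i)\<close>, which add up to 1.\<close>

lemma mahler_inequality:
  fixes a b :: "'a \<Rightarrow> real"
  assumes "finite I" "card I = r" "r > 0"
    and a: "\<And>i. i \<in> I \<Longrightarrow> a i \<ge> 0" and b: "\<And>i. i \<in> I \<Longrightarrow> b i \<ge> 0"
  shows "(\<Prod>i\<in>I. a i powr (1 / r)) + (\<Prod>i\<in>I. b i powr (1 / r)) \<le> (\<Prod>i\<in>I. (a i + b i) powr (1 / r))"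
proof (cases "\<exists>i\<in>I. a i + b i = 0")
  \<comment> \<open>The normalisation is impossible here, but \<open>0 powr (1 / r) = 0\<close>
    makes both products on the left vanish.\<close>
  case True
  then obtain i where i: "i \<in> I" "a i + b i = 0" by blast
  with a[of i] b[of i] have "a i = 0" "b i = 0" by auto
  with i assms(1) have "(\<Prod>i\<in>I. a i powr (1 / r)) = 0" "(\<Prod>i\<in>I. b i powr (1 / r)) = 0"
    by (auto simp: prod_zero_iff)
  then show ?thesis by (simp add: prod_nonneg)
next
  case False
  have ne: "I \<noteq> {}" using assms by auto
  have pos: "a i + b i > 0" if "i \<in> I" for i
    using False that a b by (smt (verit))
  have amgm: "(\<Prod>i\<in>I. (c i / (a i + b i)) powr (1 / r)) \<le> (\<Sum>i\<in>I. c i / (a i + b i) / r)"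
    if "\<forall>i\<in>I. c i \<ge> 0" for c
    using arith_geom_mean[OF \<open>finite I\<close> ne, of "\<lambda>i. c i / (a i + b i)"] that pos assms(2)
    by (simp add: prod_powr_distrib less_imp_le)
  have fac: "(\<Prod>i\<in>I. c i powr (1 / r)) =
      (\<Prod>i\<in>I. (c i / (a i + b i)) powr (1 / r)) * (\<Prod>i\<in>I. (a i + b i) powr (1 / r))"
    if "\<forall>i\<in>I. c i \<ge> 0" for c
    unfolding prod.distrib[symmetric]
  proof (rule prod.cong[OF refl])
    fix i assume "i \<in> I"
    then show "c i powr (1 / r) = (c i / (a i + b i)) powr (1 / r) * (a i + b i) powr (1 / r)"
      using pos[of i] that by (simp add: powr_mult[symmetric])
  qed
  have "(\<Prod>i\<in>I. (a i / (a i + b i)) powr (1 / r)) + (\<Prod>i\<in>I. (b i / (a i + b i)) powr (1 / r))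
      \<le> (\<Sum>i\<in>I. a i / (a i + b i) / r) + (\<Sum>i\<in>I. b i / (a i + b i) / r)"
    by (intro add_mono amgm ballI a b)
  also have "\<dots> = (\<Sum>i\<in>I. 1 / r)"
    unfolding sum.distrib[symmetric]
    by (rule sum.cong[OF refl]) (use pos in \<open>force simp: add_divide_distrib[symmetric]\<close>)
  also have "\<dots> = 1" using assms by simp
  finally have le: "(\<Prod>i\<in>I. (a i / (a i + b i)) powr (1 / r)) + (\<Prod>i\<in>I. (b i / (a i + b i)) powr (1 / r)) \<le> 1" .
  have "\<forall>i\<in>I. a i \<ge> 0" "\<forall>i\<in>I. b i \<ge> 0" using a b by auto
  note f = this[THEN fac]
  show ?thesis
    unfolding f distrib_right[symmetric]
    by (intro mult_left_le_one_le le) (auto intro!: prod_nonneg add_nonneg_nonneg)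
qed

lemma sum_Pow_insert:
  assumes "finite E" "e \<notin> E"
  shows "(\<Sum>S\<in>Pow (insert e E). f S) = (\<Sum>S\<in>Pow E. f S + f (insert e S))"
proof -
  have "inj_on (insert e) (Pow E)" using assms(2) by (auto simp: inj_on_def)
  then have "(\<Sum>S\<in>insert e ` Pow E. f S) = (\<Sum>S\<in>Pow E. f (insert e S))"
    by (simp add: sum.reindex)
  moreover have "Pow E \<inter> insert e ` Pow E = {}" using assms(2) by auto
  ultimately show ?thesis
    using assms(1) by (simp add: Pow_insert sum.union_disjoint sum.distrib)
qed

lemma sum_Pow_power_card:
  fixes x :: "'b::comm_ring_1"
  assumes "finite E"
  shows "(\<Sum>S\<in>Pow E. x ^ card S) = (1 + x) ^ card E"
  using assms
proof (induction E)
  case (insert e E)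
  have "(\<Sum>S\<in>Pow (insert e E). x ^ card S) = (\<Sum>S\<in>Pow E. (1 + x) * x ^ card S)"
    unfolding sum_Pow_insert[OF insert(1,2)]
  proof (rule sum.cong[OF refl])
    fix S assume "S \<in> Pow E"
    then have "finite S" "e \<notin> S" using insert by (auto intro: finite_subset)
    then show "x ^ card S + x ^ card (insert e S) = (1 + x) * x ^ card S"
      by (simp add: algebra_simps)
  qed
  with insert show ?case by (simp add: sum_distrib_left[symmetric])
qed simp

text \<open>Induction on \<open>E\<close>, summing out one element \<open>e\<close> at a time.
  Exactly \<open>r\<close> of the factors depend on whether \<open>e\<close> lies in
  \<open>S\<close>, so Mahler's inequality with exponents \<open>1 / r\<close> moves the sum inside
  the product. The functions \<open>A\<close> change at each step, hence the generality in
  \<open>A\<close>.\<close>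

lemma finner_inequality_subsets:
  fixes A :: "'v \<Rightarrow> 'e set \<Rightarrow> real" and star :: "'v \<Rightarrow> 'e set"
  assumes "finite E" "finite V" "r > 0" "x \<ge> 0"
    and "\<And>e. e \<in> E \<Longrightarrow> card {v \<in> V. e \<in> star v} = r"
    and "\<And>v S. A v S \<ge> 0"
  shows "(\<Sum>S\<in>Pow E. x ^ card S * (\<Prod>v\<in>V. A v (S \<inter> star v) powr (1 / r)))
    \<le> (\<Prod>v\<in>V. (\<Sum>S\<in>Pow (E \<inter> star v). x ^ card S * A v S) powr (1 / r))"
  using assms(1,5,6)
proof (induction E arbitrary: A)
  case empty
  then show ?case by simp
next
  case (insert e E A)
  define I J where "I = {v \<in> V. e \<in> star v}" and "J = {v \<in> V. e \<notin> star v}"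
  have IJ: "V = I \<union> J" "I \<inter> J = {}" "finite I" "finite J"
    unfolding I_def J_def using assms(2) by auto
  have cI: "card I = r" unfolding I_def using insert.prems by simp
  \<comment> \<open>\<open>G\<close> is \<open>A\<close> with the choice of \<open>e\<close> summed
    out, which only affects the \<open>v\<close> whose star contains \<open>e\<close>.\<close>
  define G where "G v S = (if e \<in> star v then A v S + x * A v (insert e S) else A v S)" for v S
  have Gnn: "G v S \<ge> 0" for v S unfolding G_def using insert.prems assms(4) by simp
  \<comment> \<open>The weight \<open>x\<close> of \<open>e\<close> is shared equally: each of the
    \<open>r\<close> factors indexed by \<open>I\<close> receives
    \<open>x powr (1 / r)\<close>.\<close>
  have x_pow: "(x powr (1 / r)) ^ r = x"
    using assms(3,4) by (simp add: powr_realpow'[symmetric] powr_powr)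
  have step: "x ^ card S * (\<Prod>v\<in>V. A v (S \<inter> star v) powr (1 / r))
      + x ^ card (insert e S) * (\<Prod>v\<in>V. A v (insert e S \<inter> star v) powr (1 / r))
      \<le> x ^ card S * (\<Prod>v\<in>V. G v (S \<inter> star v) powr (1 / r))" if S: "S \<in> Pow E" for S
  proof -
    let ?J = "\<Prod>v\<in>J. A v (S \<inter> star v) powr (1 / r)"
    let ?I = "\<Prod>v\<in>I. A v (S \<inter> star v) powr (1 / r)"
    let ?I' = "\<Prod>v\<in>I. A v (insert e (S \<inter> star v)) powr (1 / r)"
    have fin: "finite S" "e \<notin> S" using S insert by (auto intro: finite_subset)
    have 1: "(\<Prod>v\<in>V. A v (S \<inter> star v) powr (1 / r)) = ?I * ?J"
      unfolding IJ(1) using IJ by (simp add: prod.union_disjoint)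
    have "(\<Prod>v\<in>V. A v (insert e S \<inter> star v) powr (1 / r)) =
        (\<Prod>v\<in>I. A v (insert e S \<inter> star v) powr (1 / r)) * (\<Prod>v\<in>J. A v (insert e S \<inter> star v) powr (1 / r))"
      unfolding IJ(1) using IJ by (simp add: prod.union_disjoint)
    also have "\<dots> = ?I' * ?J"
      by (intro arg_cong2[where f = "(*)"] prod.cong refl) (auto simp: I_def J_def)
    finally have 2: "(\<Prod>v\<in>V. A v (insert e S \<inter> star v) powr (1 / r)) = ?I' * ?J" .
    have "(\<Prod>v\<in>V. G v (S \<inter> star v) powr (1 / r)) =
        (\<Prod>v\<in>I. G v (S \<inter> star v) powr (1 / r)) * (\<Prod>v\<in>J. G v (S \<inter> star v) powr (1 / r))"
      unfolding IJ(1) using IJ by (simp add: prod.union_disjoint)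
    also have "\<dots> = (\<Prod>v\<in>I. (A v (S \<inter> star v) + x * A v (insert e (S \<inter> star v))) powr (1 / r)) * ?J"
      by (intro arg_cong2[where f = "(*)"] prod.cong refl) (auto simp: I_def J_def G_def)
    finally have 3: "(\<Prod>v\<in>V. G v (S \<inter> star v) powr (1 / r)) =
      (\<Prod>v\<in>I. (A v (S \<inter> star v) + x * A v (insert e (S \<inter> star v))) powr (1 / r)) * ?J" .
    have "x * ?I' = (\<Prod>v\<in>I. (x * A v (insert e (S \<inter> star v))) powr (1 / r))"
      using insert.prems assms(4) cI x_pow by (simp add: powr_mult prod.distrib)
    then have "?I + x * ?I' \<le> (\<Prod>v\<in>I. (A v (S \<inter> star v) + x * A v (insert e (S \<inter> star v))) powr (1 / r))"
      using mahler_inequality[OF IJ(3) cI assms(3), of "\<lambda>v. A v (S \<inter> star v)" "\<lambda>v. x * A v (insert e (S \<inter> star v))"]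
        insert.prems assms(4) by simp
    then have "x ^ card S * ((?I + x * ?I') * ?J) \<le> x ^ card S * (\<Prod>v\<in>V. G v (S \<inter> star v) powr (1 / r))"
      unfolding 3 using assms(4) by (intro mult_left_mono mult_right_mono) (auto intro: prod_nonneg)
    then show ?thesis unfolding 1 2 using fin by (simp add: algebra_simps)
  qed
  have G_sum: "(\<Sum>S\<in>Pow (insert e E \<inter> star v). x ^ card S * A v S) = (\<Sum>S\<in>Pow (E \<inter> star v). x ^ card S * G v S)" for v
  proof (cases "e \<in> star v")
    case True
    have "(\<Sum>S\<in>Pow (insert e (E \<inter> star v)). x ^ card S * A v S) = (\<Sum>S\<in>Pow (E \<inter> star v). x ^ card S * G v S)"
    proof (subst sum_Pow_insert; (intro sum.cong refl)?)
      fix S assume "S \<in> Pow (E \<inter> star v)"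
      then have "finite S" "e \<notin> S" using insert by (auto intro: finite_subset)
      then show "x ^ card S * A v S + x ^ card (insert e S) * A v (insert e S) = x ^ card S * G v S"
        using True by (simp add: G_def algebra_simps)
    qed (use insert in auto)
    then show ?thesis using True by simp
  qed (simp add: G_def)
  have "(\<Sum>S\<in>Pow (insert e E). x ^ card S * (\<Prod>v\<in>V. A v (S \<inter> star v) powr (1 / r)))
     \<le> (\<Sum>S\<in>Pow E. x ^ card S * (\<Prod>v\<in>V. G v (S \<inter> star v) powr (1 / r)))"
    unfolding sum_Pow_insert[OF insert(1,2)] by (rule sum_mono[OF step])
  also have "\<dots> \<le> (\<Prod>v\<in>V. (\<Sum>S\<in>Pow (E \<inter> star v). x ^ card S * G v S) powr (1 / r))"
    by (rule insert.IH) (use insert.prems Gnn in auto)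
  finally show ?case unfolding G_sum .
qed

subsection \<open>Simplicial boundaries and hypertrees\<close>

lemma incidence_nonzeroD:
  assumes "incidence \<rho> \<sigma> \<noteq> 0"
  obtains v where "v \<in> \<sigma>" "\<rho> = \<sigma> - {v}"
proof -
  have "\<exists>v\<in>\<sigma>. \<rho> = \<sigma> - {v}"
  proof (rule ccontr)
    assume "\<not> ?thesis"
    then have "incidence \<rho> \<sigma> = 0" unfolding incidence_def by (intro sum.neutral) auto
    with assms show False by simp
  qed
  with that show thesis by blast
qed

lemma incidence_remove:
  assumes "finite \<sigma>" "v \<in> \<sigma>"
  shows "incidence (\<sigma> - {v}) \<sigma> = (- 1) ^ card {u \<in> \<sigma>. u < v}"
proof -
  have "incidence (\<sigma> - {v}) \<sigma> = (\<Sum>w\<in>\<sigma>. if w = v then (- 1) ^ card {u \<in> \<sigma>. u < w} else 0)"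
    unfolding incidence_def by (rule sum.cong[OF refl]) (use assms in auto)
  with assms show ?thesis by simp
qed

lemma incidence_remove_nonzero:
  assumes "finite \<sigma>" "v \<in> \<sigma>"
  shows "incidence (\<sigma> - {v}) \<sigma> \<noteq> 0"
  unfolding incidence_remove[OF assms] by simp

text \<open>Deleting the smaller vertex \<open>u\<close> lowers the position of \<open>v\<close> by
  one, while deleting \<open>v\<close> leaves the position of \<open>u\<close> unchanged. So the two
  orders of deletion carry opposite signs.\<close>

lemma position_sign_swap:
  fixes \<sigma> :: "nat set"
  assumes "finite \<sigma>" "u \<in> \<sigma>" "v \<in> \<sigma>" "u < v"
  shows "(- 1 :: rat) ^ card {w \<in> \<sigma>. w < v} * (- 1) ^ card {w \<in> \<sigma> - {v}. w < u} =
    - ((- 1) ^ card {w \<in> \<sigma>. w < u} * (- 1) ^ card {w \<in> \<sigma> - {u}. w < v})"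
proof -
  have 1: "{w \<in> \<sigma> - {v}. w < u} = {w \<in> \<sigma>. w < u}" using assms by auto
  have 2: "{w \<in> \<sigma>. w < v} = insert u {w \<in> \<sigma> - {u}. w < v}" using assms by auto
  have "card {w \<in> \<sigma>. w < v} = Suc (card {w \<in> \<sigma> - {u}. w < v})"
    unfolding 2 using assms by (subst card_insert_disjoint) auto
  then show ?thesis unfolding 1 by simp
qed

text \<open>The boundary of a boundary is zero. \<open>R\<close> may be any finite family containing
  the facets of \<open>\<sigma>\<close>, so this serves both for the faces of a complex and for the
  family of all \<open>d\<close>-sets.\<close>

lemma incidence_incidence:
  assumes "finite \<sigma>" "finite R" and R: "\<And>v. v \<in> \<sigma> \<Longrightarrow> \<sigma> - {v} \<in> R"
  shows "(\<Sum>\<tau>\<in>R. incidence \<rho> \<tau> * incidence \<tau> \<sigma>) = 0"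
proof -
  define s :: "nat set \<Rightarrow> nat \<Rightarrow> rat" where "s \<sigma> v = (- 1) ^ card {u \<in> \<sigma>. u < v}" for \<sigma> v
  \<comment> \<open>The contribution to the coefficient of \<open>\<rho>\<close> from deleting first
    \<open>v\<close> and then \<open>u\<close>.\<close>
  define f where "f v u = (if u \<noteq> v \<and> \<rho> = \<sigma> - {v} - {u} then s \<sigma> v * s (\<sigma> - {v}) u else 0)" for v u
  have anti: "f v u = - f u v" if "u \<in> \<sigma>" "v \<in> \<sigma>" for u v
  proof -
    have "\<sigma> - {v} - {u} = \<sigma> - {u} - {v}" by blast
    moreover have "s \<sigma> v * s (\<sigma> - {v}) u = - (s \<sigma> u * s (\<sigma> - {u}) v)" if "u \<noteq> v"
    proof (cases "u < v")
      case True
      show ?thesis unfolding s_def by (rule position_sign_swap) fact+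
    next
      case False
      with that have "v < u" by simp
      have "s \<sigma> u * s (\<sigma> - {u}) v = - (s \<sigma> v * s (\<sigma> - {v}) u)"
        unfolding s_def by (rule position_sign_swap) fact+
      then show ?thesis by simp
    qed
    ultimately show ?thesis unfolding f_def by simp
  qed
  have "(\<Sum>\<tau>\<in>R. incidence \<rho> \<tau> * incidence \<tau> \<sigma>) =
      (\<Sum>\<tau>\<in>R. \<Sum>v\<in>\<sigma>. if \<tau> = \<sigma> - {v} then incidence \<rho> (\<sigma> - {v}) * s \<sigma> v else 0)"
  proof (rule sum.cong[OF refl])
    fix \<tau>
    show "incidence \<rho> \<tau> * incidence \<tau> \<sigma> =
        (\<Sum>v\<in>\<sigma>. if \<tau> = \<sigma> - {v} then incidence \<rho> (\<sigma> - {v}) * s \<sigma> v else 0)"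
      unfolding incidence_def[of \<tau> \<sigma>] sum_distrib_left
      by (rule sum.cong) (simp_all add: s_def)
  qed
  also have "\<dots> = (\<Sum>v\<in>\<sigma>. incidence \<rho> (\<sigma> - {v}) * s \<sigma> v)"
    by (subst sum.swap) (simp add: assms(2) R)
  also have "\<dots> = (\<Sum>v\<in>\<sigma>. \<Sum>u\<in>\<sigma>. f v u)"
  proof (rule sum.cong[OF refl])
    fix v assume "v \<in> \<sigma>"
    have "incidence \<rho> (\<sigma> - {v}) * s \<sigma> v = (\<Sum>u\<in>\<sigma> - {v}. f v u)"
      unfolding incidence_def sum_distrib_right
      by (rule sum.cong[OF refl]) (auto simp: f_def s_def)
    also have "\<dots> = (\<Sum>u\<in>\<sigma>. f v u)"
      by (rule sum.mono_neutral_left) (use assms(1) in \<open>auto simp: f_def\<close>)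
    finally show "incidence \<rho> (\<sigma> - {v}) * s \<sigma> v = (\<Sum>u\<in>\<sigma>. f v u)" .
  qed
  finally have S: "(\<Sum>\<tau>\<in>R. incidence \<rho> \<tau> * incidence \<tau> \<sigma>) = (\<Sum>v\<in>\<sigma>. \<Sum>u\<in>\<sigma>. f v u)" .
  \<comment> \<open>Exchanging the summation indices and using antisymmetry makes the sum equal to
    its own negative.\<close>
  have "(\<Sum>v\<in>\<sigma>. \<Sum>u\<in>\<sigma>. f v u) = (\<Sum>v\<in>\<sigma>. \<Sum>u\<in>\<sigma>. f u v)"
    by (rule sum.swap)
  also have "\<dots> = (\<Sum>v\<in>\<sigma>. \<Sum>u\<in>\<sigma>. - f v u)"
    by (intro sum.cong refl anti)
  also have "\<dots> = - (\<Sum>v\<in>\<sigma>. \<Sum>u\<in>\<sigma>. f v u)"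
    by (simp add: sum_negf)
  finally show ?thesis unfolding S by linarith
qed

text \<open>Gaussian elimination: fewer equations than unknowns. Extending the solution by 0 outside
  \<open>S\<close> makes it usable as a chain.\<close>

lemma homogeneous_system_nontrivial_solution:
  fixes M :: "'r \<Rightarrow> 's \<Rightarrow> 'k::field"
  assumes "finite R" "finite S" "card R < card S"
  shows "\<exists>c. (\<exists>s\<in>S. c s \<noteq> 0) \<and> (\<forall>s. s \<notin> S \<longrightarrow> c s = 0) \<and> (\<forall>r\<in>R. (\<Sum>s\<in>S. M r s * c s) = 0)"
  using assms
proof (induction R arbitrary: S M)
  case empty
  then obtain t where "t \<in> S" by force
  then show ?case by (intro exI[of _ "\<lambda>s. if s = t then 1 else 0"]) auto
next
  case (insert r R)
  show ?case
  proof (cases "\<exists>t\<in>S. M r t \<noteq> 0")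
    case False
    then show ?thesis using insert.IH[of S M] insert by auto
  next
    case True
    then obtain t where t: "t \<in> S" "M r t \<noteq> 0" by blast
    \<comment> \<open>Row \<open>q\<close> after subtracting the multiple of row \<open>r\<close>
      that clears the pivot column \<open>t\<close>.\<close>
    define M' where "M' q s = M q s - M q t * M r s / M r t" for q s
    have "card R < card (S - {t})" using insert t by simp
    from insert.IH[OF _ this, of M'] insert.prems obtain c where
      c: "\<exists>s\<in>S - {t}. c s \<noteq> 0" "\<And>s. s \<notin> S - {t} \<Longrightarrow> c s = 0"
        "\<And>q. q \<in> R \<Longrightarrow> (\<Sum>s\<in>S - {t}. M' q s * c s) = 0" by auto
    \<comment> \<open>Back substitution: the value of the unknown \<open>t\<close> that satisfies
      equation \<open>r\<close>.\<close>
    define a where "a = - (\<Sum>s\<in>S - {t}. M r s * c s) / M r t"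
    define c' where "c' = c(t := a)"
    have eq: "(\<Sum>s\<in>S. M q s * c' s) = M q t * a + (\<Sum>s\<in>S - {t}. M q s * c s)" for q
      using t insert.prems by (subst sum.remove[of _ t]) (auto simp: c'_def intro!: sum.cong)
    have "(\<Sum>s\<in>S. M q s * c' s) = 0" if "q \<in> R" for q
    proof -
      have "(\<Sum>s\<in>S - {t}. M' q s * c s) =
          (\<Sum>s\<in>S - {t}. M q s * c s) - (\<Sum>s\<in>S - {t}. (M q t / M r t) * (M r s * c s))"
        unfolding sum_subtractf[symmetric] by (rule sum.cong) (auto simp: M'_def algebra_simps)
      also have "(\<Sum>s\<in>S - {t}. (M q t / M r t) * (M r s * c s)) = - (M q t * a)"
        by (simp only: sum_distrib_left[symmetric]) (simp add: a_def)
      finally show ?thesis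
        unfolding eq using c(3)[OF that] by (simp add: add.commute)
    qed
    moreover have "(\<Sum>s\<in>S. M r s * c' s) = 0"
      unfolding eq using t by (simp add: a_def)
    ultimately show ?thesis using c t by (intro exI[of _ c']) (auto simp: c'_def)
  qed
qed

text \<open>A cycle supported on sets through \<open>v\<close> vanishes: in its boundary, the
  coefficient of \<open>\<tau> - {v}\<close> comes from \<open>\<tau>\<close> alone, since any other
  set through \<open>v\<close> with this facet would also have to lose \<open>v\<close>.\<close>

lemma cycle_avoiding_vertex_eq_zero:
  fixes z :: "nat set \<Rightarrow> rat"
  assumes "finite D" "\<And>\<tau>. \<tau> \<in> D \<Longrightarrow> finite \<tau>"
    and cycle: "\<And>\<rho>. (\<Sum>\<tau>\<in>D. incidence \<rho> \<tau> * z \<tau>) = 0"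
    and supp: "\<And>\<tau>. \<tau> \<in> D \<Longrightarrow> v \<notin> \<tau> \<Longrightarrow> z \<tau> = 0"
    and "\<tau> \<in> D"
  shows "z \<tau> = 0"
proof (cases "v \<in> \<tau>")
  case True
  have "incidence (\<tau> - {v}) \<tau>' * z \<tau>' = 0" if "\<tau>' \<in> D - {\<tau>}" for \<tau>'
  proof (rule ccontr)
    assume *: "\<not> ?thesis"
    then have "v \<in> \<tau>'" using supp that by auto
    moreover obtain w where "w \<in> \<tau>'" "\<tau> - {v} = \<tau>' - {w}"
      using * by (auto elim: incidence_nonzeroD)
    ultimately show False using True that by blast
  qed
  then have "(\<Sum>\<tau>'\<in>D - {\<tau>}. incidence (\<tau> - {v}) \<tau>' * z \<tau>') = 0"
    by (rule sum.neutral[OF ballI])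
  then have "incidence (\<tau> - {v}) \<tau> * z \<tau> = 0"
    using cycle[of "\<tau> - {v}"] sum.remove[OF assms(1) \<open>\<tau> \<in> D\<close>, of "\<lambda>\<tau>'. incidence (\<tau> - {v}) \<tau>' * z \<tau>'"]
    by simp
  then show ?thesis using incidence_remove_nonzero[of \<tau> v] assms True by simp
qed (use assms in auto)

text \<open>Turns the quotient-group statement into one about chains. The boundaries form the only
  coset, and \<open>c\<close> lies in its own coset because 0 is a boundary.\<close>

lemma boundary_of_trivial_homology:
  assumes "trivial_group (rational_homology_group K p)"
    and "c \<in> rational_chains K p" "boundary_map K p c = (\<lambda>_. 0)"
  shows "c \<in> boundary_map K (p + 1) ` rational_chains K (p + 1)"
proof -
  let ?B = "boundary_map K (p + 1) ` rational_chains K (p + 1)"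
  have "boundary_map K (p + 1) (\<lambda>_. 0) = (\<lambda>_. 0)" "(\<lambda>_. 0) \<in> rational_chains K (p + 1)"
    by (auto simp: boundary_map_def rational_chains_def)
  then have "(\<lambda>_. 0) \<in> ?B" by (metis imageI)
  then have "c \<in> ?B #>\<^bsub>cycle_group K p\<^esub> c"
    unfolding r_coset_def cycle_group_def by (intro UN_I[of "\<lambda>_. 0"]) auto
  moreover have "?B #>\<^bsub>cycle_group K p\<^esub> c = ?B"
    using assms
    by (auto simp: trivial_group_def rational_homology_group_def FactGroup_def RCOSETS_def cycle_group_def)
  ultimately show ?thesis by simp
qed

lemma finite_complex:
  assumes "complex_on n K"
  shows "finite K"
  by (rule finite_subset[of _ "Pow {1..n}"]) (use assms in \<open>auto simp: complex_on_def\<close>)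

lemma finite_faces:
  assumes "complex_on n K"
  shows "finite (faces K p)"
  using finite_complex[OF assms] by (simp add: faces_def)

lemma hypertree_faces_subset:
  assumes "hypertree n d T"
  shows "faces T d \<subseteq> {\<sigma>. \<sigma> \<subseteq> {1..n} \<and> card \<sigma> = d + 1}"
  using assms by (auto simp: hypertree_def complex_on_def faces_def)

text \<open>Add a vertex to \<open>\<tau>\<close> to get a \<open>d\<close>-simplex
  \<open>\<sigma>\<close>. Its facets all lie in the full skeleton, so its boundary is a cycle of
  \<open>T\<close>, hence the boundary of a \<open>d\<close>-chain of \<open>T\<close>. The nonzero
  coefficient at \<open>\<tau>\<close> must come from a \<open>d\<close>-face of \<open>T\<close>
  above \<open>\<tau>\<close>.\<close>

lemma hypertree_covers:
  assumes T: "hypertree n d T" and "d \<ge> 1" "n > d"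
    and \<tau>: "\<tau> \<subseteq> {1..n}" "card \<tau> = d"
  shows "\<exists>\<sigma>\<in>faces T d. \<tau> \<subseteq> \<sigma>"
proof -
  have fin: "finite \<tau>" using finite_subset[OF \<tau>(1)] by simp
  have "\<not> {1..n} \<subseteq> \<tau>"
  proof
    assume "{1..n} \<subseteq> \<tau>"
    from card_mono[OF fin this] show False using \<tau>(2) \<open>n > d\<close> by simp
  qed
  then obtain w where w: "w \<in> {1..n}" "w \<notin> \<tau>" by blast
  define \<sigma> where "\<sigma> = insert w \<tau>"
  have \<sigma>: "finite \<sigma>" "card \<sigma> = d + 1" "\<sigma> \<subseteq> {1..n}" "\<tau> = \<sigma> - {w}" "w \<in> \<sigma>"
    using fin w \<tau> by (simp_all add: \<sigma>_def)
  have facet: "\<sigma> - {v} \<in> faces T (d - 1)" if "v \<in> \<sigma>" for v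
  proof -
    have "card (\<sigma> - {v}) = d" using \<sigma> that by simp
    moreover have "\<sigma> - {v} \<noteq> {}" using calculation \<open>d \<ge> 1\<close> by (intro notI) (simp only: card.empty)
    moreover have "\<sigma> - {v} \<subseteq> {1..n}" using \<sigma>(3) by blast
    moreover have "full_skeleton n d T" using T by (simp add: hypertree_def)
    ultimately have "\<sigma> - {v} \<in> T" by (simp add: full_skeleton_def)
    then show ?thesis using \<open>card (\<sigma> - {v}) = d\<close> \<open>d \<ge> 1\<close> by (simp add: faces_def)
  qed
  \<comment> \<open>The boundary of \<open>\<sigma>\<close>; it is a chain of \<open>T\<close> even
    when \<open>\<sigma>\<close> itself is not a face of \<open>T\<close>.\<close>
  define z where "z = (\<lambda>\<tau>. incidence \<tau> \<sigma>)"
  have "z \<in> rational_chains T (d - 1)"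
    unfolding z_def rational_chains_def
  proof (intro CollectI allI impI, rule ccontr)
    fix \<rho> assume "\<rho> \<notin> faces T (d - 1)" "incidence \<rho> \<sigma> \<noteq> 0"
    from this(2) obtain v where "v \<in> \<sigma>" "\<rho> = \<sigma> - {v}" by (rule incidence_nonzeroD)
    with facet \<open>\<rho> \<notin> faces T (d - 1)\<close> show False by simp
  qed
  moreover have "boundary_map T (d - 1) z = (\<lambda>_. 0)"
  proof -
    have "finite (faces T (d - 1))" using T by (auto simp: hypertree_def intro: finite_faces)
    then have "(\<Sum>\<tau>\<in>faces T (d - 1). incidence \<rho> \<tau> * incidence \<tau> \<sigma>) = 0" for \<rho>
      using \<sigma>(1) facet by (intro incidence_incidence)
    then show ?thesis unfolding z_def boundary_map_def by auto
  qed
  ultimately have "z \<in> boundary_map T (d - 1 + 1) ` rational_chains T (d - 1 + 1)"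
    using T by (intro boundary_of_trivial_homology) (auto simp: hypertree_def)
  then obtain c where "z = boundary_map T d c" using \<open>d \<ge> 1\<close> by auto
  moreover have "z \<tau> \<noteq> 0"
    using incidence_remove_nonzero[OF \<sigma>(1,5)] by (simp add: z_def \<sigma>(4))
  ultimately have "boundary_map T d c \<tau> \<noteq> 0" by simp
  then have "(\<Sum>\<sigma>\<in>faces T d. incidence \<tau> \<sigma> * c \<sigma>) \<noteq> 0"
    by (auto simp: boundary_map_def split: if_splits)
  then obtain \<sigma>' where "\<sigma>' \<in> faces T d" "incidence \<tau> \<sigma>' * c \<sigma>' \<noteq> 0"
    by (rule sum.not_neutral_contains_not_neutral)
  moreover from this have "incidence \<tau> \<sigma>' \<noteq> 0" by simp
  then have "\<tau> \<subseteq> \<sigma>'" by (rule incidence_nonzeroD) auto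
  ultimately show ?thesis by blast
qed

text \<open>With more faces, some nonzero \<open>d\<close>-chain has a boundary vanishing on all
  \<open>d\<close>-sets that avoid the vertex \<open>n\<close>. This boundary is a cycle supported
  on sets through \<open>n\<close>, hence zero, and the chain is a nonzero \<open>d\<close>-cycle,
  against the vanishing of the top homology.\<close>

lemma hypertree_card_faces_le:
  assumes T: "hypertree n d T"
  shows "card (faces T d) \<le> (n - 1) choose d"
proof (rule ccontr)
  assume "\<not> ?thesis"
  moreover have "card {\<tau>. \<tau> \<subseteq> {1..<n} \<and> card \<tau> = d} = (n - 1) choose d"
    by (subst n_subsets) auto
  ultimately have "card {\<tau>. \<tau> \<subseteq> {1..<n} \<and> card \<tau> = d} < card (faces T d)" by simp
  moreover have finF: "finite (faces T d)" using T by (auto simp: hypertree_def finite_faces)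
  \<comment> \<open>The equations are indexed by the \<open>d\<close>-subsets of
    \<open>{1..<n}\<close>, which is where \<open>n - 1\<close> enters the binomial
    coefficient.\<close>
  ultimately obtain c where c: "\<exists>\<sigma>\<in>faces T d. c \<sigma> \<noteq> 0" "\<And>\<sigma>. \<sigma> \<notin> faces T d \<Longrightarrow> c \<sigma> = 0"
    and c0: "\<And>\<tau>. \<tau> \<subseteq> {1..<n} \<Longrightarrow> card \<tau> = d \<Longrightarrow> (\<Sum>\<sigma>\<in>faces T d. incidence \<tau> \<sigma> * c \<sigma>) = 0"
    using homogeneous_system_nontrivial_solution[of "{\<tau>. \<tau> \<subseteq> {1..<n} \<and> card \<tau> = d}" "faces T d" incidence]
    by auto
  define D where "D = {\<tau>. \<tau> \<subseteq> {1..n} \<and> card \<tau> = d}"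
  define z where "z \<tau> = (\<Sum>\<sigma>\<in>faces T d. incidence \<tau> \<sigma> * c \<sigma>)" for \<tau>
  have finD: "finite D" "\<And>\<tau>. \<tau> \<in> D \<Longrightarrow> finite \<tau>" by (auto simp: D_def intro: finite_subset)
  have facet: "finite \<sigma> \<and> (\<forall>v\<in>\<sigma>. \<sigma> - {v} \<in> D)" if "\<sigma> \<in> faces T d" for \<sigma>
  proof -
    have "finite \<sigma>" "\<sigma> \<subseteq> {1..n}" "card \<sigma> = d + 1"
      using that hypertree_faces_subset[OF T] by (auto intro: finite_subset)
    then show ?thesis by (auto simp: D_def)
  qed
  have "(\<Sum>\<tau>\<in>D. incidence \<rho> \<tau> * z \<tau>) = 0" for \<rho>
  proof -
    have "(\<Sum>\<tau>\<in>D. incidence \<rho> \<tau> * z \<tau>) =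
        (\<Sum>\<sigma>\<in>faces T d. (\<Sum>\<tau>\<in>D. incidence \<rho> \<tau> * incidence \<tau> \<sigma>) * c \<sigma>)"
      unfolding z_def sum_distrib_left sum_distrib_right by (subst sum.swap) (simp add: mult.assoc)
    also have "\<dots> = 0"
      using facet finD by (intro sum.neutral) (simp add: incidence_incidence)
    finally show ?thesis .
  qed
  moreover have "z \<tau> = 0" if "\<tau> \<in> D" "n \<notin> \<tau>" for \<tau>
  proof -
    have "\<tau> \<subseteq> {1..<n}" using that by (auto simp: D_def le_less)
    then show ?thesis using that c0 by (auto simp: z_def D_def)
  qed
  ultimately have zD: "z \<tau> = 0" if "\<tau> \<in> D" for \<tau>
    using cycle_avoiding_vertex_eq_zero[OF finD, of z n] that by blast
  have "z \<tau> = 0" for \<tau>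
  proof (cases "\<tau> \<in> D")
    case False
    then have "incidence \<tau> \<sigma> = 0" if "\<sigma> \<in> faces T d" for \<sigma>
      using facet[OF that] incidence_nonzeroD[of \<tau> \<sigma>] by blast
    then show ?thesis by (simp add: z_def)
  qed (rule zD)
  then have "boundary_map T d c = (\<lambda>_. 0)" by (auto simp: boundary_map_def z_def)
  then have "c \<in> boundary_map T (d + 1) ` rational_chains T (d + 1)"
    using T c by (intro boundary_of_trivial_homology) (auto simp: hypertree_def rational_chains_def)
  \<comment> \<open>Above the dimension there are no chains to bound anything, so 0 is the only
    boundary.\<close>
  moreover have "faces T (d + 1) = {}"
    using T by (force simp: hypertree_def has_dimension_def faces_def)
  ultimately have "c = (\<lambda>_. 0)" by (auto simp: boundary_map_def)
  with c show False by auto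
qed

text \<open>The full skeleton and the dimension bound fix everything in a hypertree except its
  \<open>d\<close>-faces, so families of \<open>d\<close>-faces can be counted instead.\<close>

lemma inj_on_faces_hypertrees: "inj_on (\<lambda>T. faces T d) (hypertrees n d)"
proof -
  have *: "T = {\<sigma>. \<sigma> \<subseteq> {1..n} \<and> \<sigma> \<noteq> {} \<and> card \<sigma> \<le> d} \<union> faces T d"
    if "hypertree n d T" for T
  proof (intro equalityI subsetI)
    fix \<sigma> assume "\<sigma> \<in> T"
    then have "\<sigma> \<subseteq> {1..n}" "\<sigma> \<noteq> {}" "card \<sigma> \<le> d + 1"
      using that unfolding hypertree_def complex_on_def has_dimension_def by blast+
    with \<open>\<sigma> \<in> T\<close> show "\<sigma> \<in> {\<sigma>. \<sigma> \<subseteq> {1..n} \<and> \<sigma> \<noteq> {} \<and> card \<sigma> \<le> d} \<union> faces T d"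
      by (cases "card \<sigma> = d + 1") (auto simp: faces_def)
  qed (use that in \<open>auto simp: hypertree_def full_skeleton_def faces_def\<close>)
  show ?thesis
  proof (rule inj_onI)
    fix T T' assume "T \<in> hypertrees n d" "T' \<in> hypertrees n d" "faces T d = faces T' d"
    then show "T = T'" using *[of T] *[of T'] by (simp add: hypertrees_def)
  qed
qed

subsection \<open>Counting hypertrees\<close>

lemma card_supersets_one_more:
  assumes "finite X" "\<tau> \<subseteq> X"
  shows "card {\<sigma>. \<sigma> \<subseteq> X \<and> card \<sigma> = card \<tau> + 1 \<and> \<tau> \<subseteq> \<sigma>} = card X - card \<tau>"
proof -
  have fin: "finite \<tau>" using assms finite_subset by blast
  have "{\<sigma>. \<sigma> \<subseteq> X \<and> card \<sigma> = card \<tau> + 1 \<and> \<tau> \<subseteq> \<sigma>} = (\<lambda>w. insert w \<tau>) ` (X - \<tau>)"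
  proof (intro equalityI subsetI)
    fix \<sigma> assume "\<sigma> \<in> {\<sigma>. \<sigma> \<subseteq> X \<and> card \<sigma> = card \<tau> + 1 \<and> \<tau> \<subseteq> \<sigma>}"
    then have \<sigma>: "\<sigma> \<subseteq> X" "card \<sigma> = card \<tau> + 1" "\<tau> \<subseteq> \<sigma>" by auto
    then have "card (\<sigma> - \<tau>) = 1" using fin by (simp add: card_Diff_subset)
    then obtain w where "\<sigma> - \<tau> = {w}" by (rule card_1_singletonE)
    then have "\<sigma> = insert w \<tau>" "w \<in> X - \<tau>" using \<sigma> by auto
    then show "\<sigma> \<in> (\<lambda>w. insert w \<tau>) ` (X - \<tau>)" by blast
  qed (use assms fin in auto)
  moreover have "inj_on (\<lambda>w. insert w \<tau>) (X - \<tau>)" by (auto simp: inj_on_def)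
  ultimately show ?thesis using assms fin by (simp add: card_image card_Diff_subset)
qed

text \<open>Finner's inequality with the \<open>d\<close>-sets as indices and the
  \<open>(d+1)\<close>-sets as ground set; a \<open>(d+1)\<close>-set lies in the stars of its
  \<open>d + 1\<close> facets, which gives the exponent.\<close>

lemma sum_covering_families_le:
  fixes x :: real
  assumes "finite X" "x \<ge> 0"
    and C: "\<And>S. S \<in> C \<Longrightarrow> S \<subseteq> {\<sigma>. \<sigma> \<subseteq> X \<and> card \<sigma> = d + 1}"
      "\<And>S \<tau>. S \<in> C \<Longrightarrow> \<tau> \<subseteq> X \<Longrightarrow> card \<tau> = d \<Longrightarrow> \<exists>\<sigma>\<in>S. \<tau> \<subseteq> \<sigma>"
  shows "(\<Sum>S\<in>C. x ^ card S)
    \<le> (((1 + x) ^ (card X - d) - 1) powr (1 / real (d + 1))) ^ (card X choose d)"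
proof -
  define E where "E = {\<sigma>. \<sigma> \<subseteq> X \<and> card \<sigma> = d + 1}"
  define V where "V = {\<tau>. \<tau> \<subseteq> X \<and> card \<tau> = d}"
  define star where "star \<tau> = {\<sigma>. \<tau> \<subseteq> \<sigma>}" for \<tau> :: "'a set"
  \<comment> \<open>The indicator that some chosen set contains \<open>\<tau>\<close>; the product
    of these over all \<open>\<tau>\<close> is 1 on a covering family.\<close>
  define A :: "'a set \<Rightarrow> 'a set set \<Rightarrow> real" where "A \<tau> S = (if S = {} then 0 else 1)" for \<tau> S
  have fin: "finite E" "finite V" using assms(1) by (auto simp: E_def V_def)
  have "card {\<tau> \<in> V. \<sigma> \<in> star \<tau>} = d + 1" if "\<sigma> \<in> E" for \<sigma>
  proof -
    have "finite \<sigma>" "card \<sigma> = d + 1" using that assms(1) by (auto simp: E_def intro: finite_subset)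
    moreover have "{\<tau> \<in> V. \<sigma> \<in> star \<tau>} = {\<tau>. \<tau> \<subseteq> \<sigma> \<and> card \<tau> = d}"
      using that by (auto simp: E_def V_def star_def)
    ultimately show ?thesis by (simp add: n_subsets)
  qed
  then have finner: "(\<Sum>S\<in>Pow E. x ^ card S * (\<Prod>\<tau>\<in>V. A \<tau> (S \<inter> star \<tau>) powr (1 / real (d + 1))))
      \<le> (\<Prod>\<tau>\<in>V. (\<Sum>S\<in>Pow (E \<inter> star \<tau>). x ^ card S * A \<tau> S) powr (1 / real (d + 1)))"
    using fin assms(2) by (intro finner_inequality_subsets) (auto simp: A_def)
  \<comment> \<open>The star of \<open>\<tau>\<close> has \<open>card X - d\<close> members;
    excluding its empty subfamily removes the term \<open>x ^ 0 = 1\<close>.\<close>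
  have local_sum: "(\<Sum>S\<in>Pow (E \<inter> star \<tau>). x ^ card S * A \<tau> S) = (1 + x) ^ (card X - d) - 1"
    if "\<tau> \<in> V" for \<tau>
  proof -
    have "E \<inter> star \<tau> = {\<sigma>. \<sigma> \<subseteq> X \<and> card \<sigma> = card \<tau> + 1 \<and> \<tau> \<subseteq> \<sigma>}"
      using that by (auto simp: E_def V_def star_def)
    then have cd: "card (E \<inter> star \<tau>) = card X - d"
      using card_supersets_one_more[OF assms(1), of \<tau>] that by (simp add: V_def)
    have f: "finite (E \<inter> star \<tau>)" using fin by simp
    have "(\<Sum>S\<in>Pow (E \<inter> star \<tau>). x ^ card S * A \<tau> S) =
        (\<Sum>S\<in>Pow (E \<inter> star \<tau>). x ^ card S - (if S = {} then 1 else 0))"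
      by (rule sum.cong) (auto simp: A_def)
    also have "\<dots> = (1 + x) ^ (card X - d) - 1"
      using f by (simp add: sum_subtractf sum_Pow_power_card cd del: Pow_Int_eq)
    finally show ?thesis .
  qed
  have "(\<Sum>S\<in>C. x ^ card S) = (\<Sum>S\<in>C. x ^ card S * (\<Prod>\<tau>\<in>V. A \<tau> (S \<inter> star \<tau>) powr (1 / real (d + 1))))"
  proof (rule sum.cong[OF refl])
    fix S assume S: "S \<in> C"
    have "A \<tau> (S \<inter> star \<tau>) = 1" if "\<tau> \<in> V" for \<tau>
      using C(2)[OF S, of \<tau>] that by (auto simp: A_def V_def star_def)
    then show "x ^ card S = x ^ card S * (\<Prod>\<tau>\<in>V. A \<tau> (S \<inter> star \<tau>) powr (1 / real (d + 1)))"
      by simp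
  qed
  also have "\<dots> \<le> (\<Sum>S\<in>Pow E. x ^ card S * (\<Prod>\<tau>\<in>V. A \<tau> (S \<inter> star \<tau>) powr (1 / real (d + 1))))"
  proof (rule sum_mono2)
    show "C \<subseteq> Pow E" using C(1) by (auto simp: E_def)
  qed (use fin assms(2) in \<open>auto intro!: mult_nonneg_nonneg prod_nonneg\<close>)
  also note finner
  also have "(\<Prod>\<tau>\<in>V. (\<Sum>S\<in>Pow (E \<inter> star \<tau>). x ^ card S * A \<tau> S) powr (1 / real (d + 1))) =
      (((1 + x) ^ (card X - d) - 1) powr (1 / real (d + 1))) ^ card V"
    using local_sum by simp
  also have "card V = card X choose d" unfolding V_def using assms(1) by (rule n_subsets)
  finally show ?thesis .
qed

text \<open>Every hypertree has weight at least \<open>x ^ k\<close>, so the covering bound divided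
  by \<open>x ^ k\<close> bounds their number.\<close>

lemma card_hypertrees_le:
  assumes "d \<ge> 1" "n > d"
  shows "real (card (hypertrees n d)) \<le>
    (exp 1 * (1 - exp (- real (d + 1))) powr (1 / real (d + 1)) / real (d + 1) * real n) ^ ((n - 1) choose d)"
proof -
  define r where "r = real (d + 1)"
  define k where "k = (n - 1) choose d"
  \<comment> \<open>With this choice, dividing by \<open>x ^ k\<close> produces the factor
    \<open>(n / (d + 1)) ^ k\<close>, and \<open>n > d\<close> gives
    \<open>x \<le> 1\<close>.\<close>
  define x where "x = r / n"
  define Q where "Q = 1 - exp (- r)"
  define q where "q = Q powr (1 / r)"
  define L where "L = real (n - d) * x"
  have r: "r > 0" and n: "real n > 0" using assms by (auto simp: r_def)
  have x: "x > 0" "x \<le> 1" using assms by (auto simp: x_def r_def)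
  have Q: "0 < Q" "Q \<le> 1" using r by (auto simp: Q_def)
  have q: "0 < q" "q \<le> 1" using Q r by (auto simp: q_def intro: powr_le1)
  define C where "C = (\<lambda>T. faces T d) ` hypertrees n d"
  have "C \<subseteq> Pow (Pow {1..n})"
  proof
    fix S assume "S \<in> C"
    then obtain T where "hypertree n d T" "S = faces T d" by (auto simp: C_def hypertrees_def)
    then show "S \<in> Pow (Pow {1..n})" using hypertree_faces_subset[of n d T] by blast
  qed
  then have finC: "finite C" by (rule finite_subset) simp
  have "real (card (hypertrees n d)) * x ^ k = (\<Sum>S\<in>C. x ^ k)"
    using card_image[OF inj_on_faces_hypertrees, of d n] by (simp add: C_def)
  also have "\<dots> \<le> (\<Sum>S\<in>C. x ^ card S)"
    using hypertree_card_faces_le x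
    by (intro sum_mono power_decreasing) (auto simp: C_def hypertrees_def k_def)
  also have "\<dots> \<le> (((1 + x) ^ (n - d) - 1) powr (1 / r)) ^ (n choose d)"
  proof -
    have "(\<Sum>S\<in>C. x ^ card S)
        \<le> (((1 + x) ^ (card {1..n} - d) - 1) powr (1 / real (d + 1))) ^ (card {1..n} choose d)"
    proof (rule sum_covering_families_le)
      fix S assume "S \<in> C"
      then obtain T where T: "hypertree n d T" "S = faces T d" by (auto simp: C_def hypertrees_def)
      from hypertree_faces_subset[OF T(1)] T(2)
      show "S \<subseteq> {\<sigma>. \<sigma> \<subseteq> {1..n} \<and> card \<sigma> = d + 1}" by simp
      show "\<exists>\<sigma>\<in>S. \<tau> \<subseteq> \<sigma>" if "\<tau> \<subseteq> {1..n}" "card \<tau> = d" for \<tau>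
        using hypertree_covers[OF T(1) assms that] T(2) by simp
    qed (use x in auto)
    then show ?thesis by (simp add: r_def)
  qed
  also have "\<dots> \<le> ((exp L * Q) powr (1 / r)) ^ (n choose d)"
  proof (intro power_mono powr_mono2)
    have "(1 + x) ^ (n - d) \<le> exp x ^ (n - d)"
      using x by (intro power_mono) auto
    also have "\<dots> = exp L" by (simp add: L_def exp_of_nat_mult)
    finally have "(1 + x) ^ (n - d) - 1 \<le> exp L * (1 - exp (- L))"
      by (simp add: algebra_simps exp_minus)
    \<comment> \<open>This replaces the saving \<open>1 - exp (- L)\<close>, which depends on
      \<open>n\<close>, by the uniform constant \<open>Q < 1\<close>.\<close>
    also have "L \<le> r" using assms n r by (simp add: L_def x_def field_simps)
    then have "exp L * (1 - exp (- L)) \<le> exp L * Q" by (simp add: Q_def)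
    finally show "(1 + x) ^ (n - d) - 1 \<le> exp L * Q" .
  qed (use x r in auto)
  also have "\<dots> = exp (L / r) ^ (n choose d) * q ^ (n choose d)"
  proof -
    have "exp L powr (1 / r) = exp (L / r)" by (simp add: powr_def)
    then show ?thesis using Q by (simp only: powr_mult q_def power_mult_distrib)
  qed
  \<comment> \<open>Since \<open>L / r = (n - d) / n\<close>, the absorption identity for binomials
    turns the exponent into exactly \<open>k\<close>.\<close>
  also have "exp (L / r) ^ (n choose d) = exp (real k)"
  proof -
    have "real (n - d) * real (n choose d) = real n * real k"
      unfolding k_def of_nat_mult[symmetric] by (simp add: binomial_absorb_comp)
    then have "real (n choose d) * (L / r) = real k"
      using r n by (simp add: L_def x_def field_simps)
    then show ?thesis by (simp only: exp_of_nat_mult[symmetric])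
  qed
  \<comment> \<open>Keeping only \<open>k\<close> of the saved factors \<open>q\<close> suffices for
    a bound that is a single \<open>k\<close>-th power.\<close>
  also have "exp (real k) * q ^ (n choose d) \<le> exp (real k) * q ^ k"
  proof -
    have "k \<le> n choose d" unfolding k_def by (rule binomial_right_mono) simp
    then show ?thesis using q by (intro mult_left_mono power_decreasing) auto
  qed
  also have "\<dots> = (exp 1 * q / r * n) ^ k * x ^ k"
  proof -
    have "exp (real k) = exp 1 ^ k" using exp_of_nat_mult[of k "1::real"] by simp
    moreover have "exp 1 * q / r * n * x = exp 1 * q" using r n by (simp add: x_def)
    ultimately show ?thesis by (simp only: power_mult_distrib[symmetric])
  qed
  finally show ?thesis using x unfolding r_def k_def q_def Q_def by simp
qed

theorem theorem1p7:
  fixes d :: nat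
  assumes "d \<ge> 2"
  shows "\<exists>\<epsilon>::real. \<epsilon> > 0 \<and>
    (\<forall>n::nat. n > d \<longrightarrow>
      real (card (hypertrees n d)) < ((exp 1 - \<epsilon>) / real (d + 1) * real n) ^ ((n - 1) choose d))"
proof -
  define q where "q = (1 - exp (- real (d + 1))) powr (1 / real (d + 1))"
  have q: "q \<ge> 0" "q < 1"
    using powr_less_mono2[of "1 / real (d + 1)" "1 - exp (- real (d + 1))" 1] by (simp_all add: q_def)
  \<comment> \<open>Half the gap between \<open>exp 1\<close> and \<open>exp 1 * q\<close>: it is
    independent of \<open>n\<close> and leaves room for a strict inequality.\<close>
  define \<epsilon> where "\<epsilon> = exp 1 * (1 - q) / 2"
  have "\<epsilon> > 0" using q by (simp add: \<epsilon>_def)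
  moreover have "real (card (hypertrees n d)) < ((exp 1 - \<epsilon>) / real (d + 1) * real n) ^ ((n - 1) choose d)"
    if "n > d" for n
  proof -
    have "exp 1 * q < exp 1 - \<epsilon>" using q by (simp add: \<epsilon>_def field_simps)
    then have "exp 1 * q / real (d + 1) * real n < (exp 1 - \<epsilon>) / real (d + 1) * real n"
      using that by (intro mult_strict_right_mono divide_strict_right_mono) auto
    \<comment> \<open>A positive exponent keeps the inequality strict when powers are taken.\<close>
    moreover have "(n - 1) choose d > 0" using that by (simp add: zero_less_binomial)
    ultimately have "(exp 1 * q / real (d + 1) * real n) ^ ((n - 1) choose d)
        < ((exp 1 - \<epsilon>) / real (d + 1) * real n) ^ ((n - 1) choose d)"
      using q by (intro power_strict_mono) auto
    then show ?thesis using card_hypertrees_le[of d n] assms that by (simp add: q_def)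
  qed
  ultimately show ?thesis by blast
qed

end
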